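(* Assume that $$ \frac{\partial G(x)}{\partial r}=-\frac{2}{R_0}\left(I_n-\frac{x\otimes x}{|x|^2}\right)G(x),\qquad |x|=R_0, $$ where $R_0>r_c$ is a positive constant. Then, for any $x\in S(R_0)$ and any unit-speed geodesic $\gamma(t)$ of $(\mathbb{R}^n,g)$ starting at $x$ with $\gamma'(0)\in S(R_0)_x$, we have $$ \gamma(t)\in S(R_0),\qquad \forall t\ge 0. $$
   Context: Let $n\ge 2$, $r=r(x)=|x|$ the Euclidean norm, $\partial/\partial r=x/|x|$ for $x\neq 0$, $I_n$ the identity matrix; for a matrix-valued function $G$, $\partial G/\partial r$ is the entrywise radial derivative in Cartesian coordinates. $(\mathbb{R}^n,g)$ is a smooth complete Riemannian manifold, $g=\sum g_{ij}(x)dx_idx_j$, $G(x)=(g_{ij}(x))$, and there is a constant $r_c>0$ with $G(x)\frac{\partial}{\partial r}=\frac{\partial}{\partial r}$ for $|x|\ge r_c$. $S(R)$ is the Euclidean sphere of radius $R$ centred at the origin and $S(R)_x$ its tangent space at $x\in S(R)$. *)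

theory Defs
  imports "HOL-Analysis.Analysis"
begin

primrec C_k :: "nat \<Rightarrow> ('a::euclidean_space \<Rightarrow> 'b::real_normed_vector) \<Rightarrow> bool" where
  "C_k 0 f \<longleftrightarrow> continuous_on UNIV f"
| "C_k (Suc k) f \<longleftrightarrow>
     (\<forall>x. f differentiable (at x)) \<and>
     (\<forall>b\<in>Basis. C_k k (\<lambda>x. frechet_derivative f (at x) b))"

definition C_infinity :: "('a::euclidean_space \<Rightarrow> 'b::real_normed_vector) \<Rightarrow> bool" where
  "C_infinity f \<longleftrightarrow> (\<forall>k. C_k k f)"

text \<open>A Riemannian metric on \<open>\<real>\<^sup>n\<close> is given by its matrix \<open>G x\<close> in the Cartesian coordinates.\<close>

definition riemannian_metric :: "(real^'n \<Rightarrow> real^'n^'n) \<Rightarrow> bool" where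
  "riemannian_metric G \<longleftrightarrow>
     C_infinity G \<and>
     (\<forall>x. transpose (G x) = G x) \<and>
     (\<forall>x v. v \<noteq> 0 \<longrightarrow> v \<bullet> (G x *v v) > 0)"

definition partial :: "'n \<Rightarrow> (real^'n \<Rightarrow> real) \<Rightarrow> real^'n \<Rightarrow> real" where
  "partial i f x = frechet_derivative f (at x) (axis i 1)"

text \<open>\<open>christoffel G k i j\<close> is the symbol with upper index \<open>k\<close> and lower indices \<open>i\<close>, \<open>j\<close>.\<close>

definition christoffel ::
    "(real^'n \<Rightarrow> real^'n^'n) \<Rightarrow> 'n \<Rightarrow> 'n \<Rightarrow> 'n \<Rightarrow> real^'n \<Rightarrow> real" where
  "christoffel G k i j x =
     (1/2) * (\<Sum>l\<in>UNIV. matrix_inv (G x) $ k $ l *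
        (partial i (\<lambda>y. G y $ j $ l) x + partial j (\<lambda>y. G y $ i $ l) x
          - partial l (\<lambda>y. G y $ i $ j) x))"

text \<open>Curves are parametrised by an interval \<open>T\<close>; at an endpoint contained in \<open>T\<close> the
  derivatives are one-sided.\<close>

definition velocity :: "real set \<Rightarrow> (real \<Rightarrow> real^'n) \<Rightarrow> real \<Rightarrow> real^'n" where
  "velocity T \<gamma> t = vector_derivative \<gamma> (at t within T)"

definition geodesic_on ::
    "(real^'n \<Rightarrow> real^'n^'n) \<Rightarrow> real set \<Rightarrow> (real \<Rightarrow> real^'n) \<Rightarrow> bool" where
  "geodesic_on G T \<gamma> \<longleftrightarrow>
     (\<forall>t\<in>T. \<gamma> differentiable (at t within T)) \<and>
     (\<forall>t\<in>T. velocity T \<gamma> differentiable (at t within T)) \<and>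
     (\<forall>t\<in>T. \<forall>k. velocity T (velocity T \<gamma>) t $ k
        + (\<Sum>i\<in>UNIV. \<Sum>j\<in>UNIV. christoffel G k i j (\<gamma> t)
             * velocity T \<gamma> t $ i * velocity T \<gamma> t $ j) = 0)"

definition unit_speed_on ::
    "(real^'n \<Rightarrow> real^'n^'n) \<Rightarrow> real set \<Rightarrow> (real \<Rightarrow> real^'n) \<Rightarrow> bool" where
  "unit_speed_on G T \<gamma> \<longleftrightarrow>
     (\<forall>t\<in>T. sqrt (velocity T \<gamma> t \<bullet> (G (\<gamma> t) *v velocity T \<gamma> t)) = 1)"

text \<open>Completeness is geodesic completeness: every geodesic extends to all times, that is,
  the exponential map is defined on the whole tangent bundle.\<close>

definition complete_metric :: "(real^'n \<Rightarrow> real^'n^'n) \<Rightarrow> bool" where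
  "complete_metric G \<longleftrightarrow>
     (\<forall>x v. \<exists>\<gamma>. geodesic_on G UNIV \<gamma> \<and> \<gamma> 0 = x \<and> velocity UNIV \<gamma> 0 = v)"

definition radial :: "real^'n \<Rightarrow> real^'n" where
  "radial x = x /\<^sub>R norm x"

definition radial_derivative ::
    "(real^'n \<Rightarrow> real^'n^'n) \<Rightarrow> real^'n \<Rightarrow> real^'n^'n" where
  "radial_derivative G x =
     (\<chi> i j. frechet_derivative (\<lambda>y. G y $ i $ j) (at x) (radial x))"

definition outer_product :: "real^'n \<Rightarrow> real^'n \<Rightarrow> real^'n^'n" where
  "outer_product x y = (\<chi> i j. x $ i * y $ j)"

text \<open>The tangent space at \<open>x\<close> of a submanifold \<open>S\<close> of \<open>\<real>\<^sup>n\<close>: the velocities at \<open>x\<close> of the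
  smooth curves in \<open>S\<close>. Curves on the whole line suffice, as any curve germ can be
  reparametrised to one without changing its velocity at time \<open>0\<close>.\<close>

definition tangent_space :: "(real^'n) set \<Rightarrow> real^'n \<Rightarrow> (real^'n) set" where
  "tangent_space S x =
     {velocity UNIV c 0 | c. C_infinity c \<and> (\<forall>t. c t \<in> S) \<and> c 0 = x}"

end

theory Submission
  imports Defs
begin

text \<open>
  The hypothesis on the radial derivative says that the second fundamental form of the sphere
  of radius \<open>R0\<close> vanishes, so the sphere is totally geodesic. The proof turns this into a
  differential inequality for the distance of a geodesic to the sphere.

  Along a geodesic \<open>\<gamma>\<close> with velocity \<open>v\<close> put \<open>w = \<gamma> \<bullet> v\<close>, the derivative of \<open>|\<gamma>|\<^sup>2 / 2\<close>. The
  geodesic equation gives \<open>w'\<close> as \<open>v \<bullet> v\<close> minus the contraction of the Christoffel symbols with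
  \<open>\<gamma>\<close>. Where \<open>G(x) x = x\<close>, this simplifies (lemma \<open>radial_acceleration\<close>): with
  \<open>N(x) = G(x) + DG(x)[x] / 2\<close> one gets \<open>w' = v \<bullet> N(\<gamma>) v\<close>. Here the symmetry of \<open>G\<close> makes \<open>x\<close> a left
  eigenvector of the inverse of \<open>G(x)\<close>, which removes that inverse from the Christoffel symbols, and
  differentiating \<open>G(x) x = x\<close> in the direction \<open>v\<close> evaluates the mixed terms.

  On the sphere itself the hypothesis reduces \<open>N(x)\<close> to the projection matrix \<open>x \<otimes> x / |x|\<^sup>2\<close>
  (lemma \<open>metric_plus_half_euler_derivative_on_sphere\<close>). Since \<open>N\<close> is Lipschitz on bounded sets and
  \<open>x \<otimes> x / |x|\<^sup>2\<close> depends only on the direction of \<open>x\<close>, near the sphere \<open>w'\<close> differs from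
  \<open>w\<^sup>2 / |\<gamma>|\<^sup>2\<close> by at most a constant times \<open>||\<gamma>| - R0| |v|\<^sup>2\<close>
  (lemma \<open>radial_acceleration_near_sphere\<close>).

  Hence \<open>u = e\<^sup>2 + w\<^sup>2\<close> with \<open>e = (|\<gamma>|\<^sup>2 - R0\<^sup>2) / 2\<close> satisfies \<open>u' \<le> K u\<close> for as long as the curve is
  close to the sphere. It vanishes initially, because \<open>\<gamma>\<close> starts tangentially to the sphere, so
  by Gronwall's argument (lemma \<open>gronwall_zero\<close>) it vanishes for all times.
\<close>

section \<open>Smooth maps and Lipschitz bounds\<close>

lemma C_infinity_continuous:
  assumes "C_infinity f"
  shows "continuous_on S f"
proof -
  have "C_k 0 f" using assms unfolding C_infinity_def by blast
  then show ?thesis by (auto intro: continuous_on_subset)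
qed

lemma C_infinity_differentiable:
  assumes "C_infinity f"
  shows "f differentiable (at x)"
proof -
  have "C_k (Suc 0) f" using assms unfolding C_infinity_def by blast
  then show ?thesis by simp
qed

lemmas C_infinity_has_derivative =
  C_infinity_differentiable[unfolded frechet_derivative_works]

lemma C_infinity_frechet_derivative:
  assumes "C_infinity f" "b \<in> Basis"
  shows "C_infinity (\<lambda>x. frechet_derivative f (at x) b)"
  unfolding C_infinity_def
proof
  fix k
  have "C_k (Suc k) f" using assms(1) unfolding C_infinity_def by blast
  then show "C_k k (\<lambda>x. frechet_derivative f (at x) b)" using assms(2) by simp
qed

lemma frechet_derivative_basis_expansion:
  fixes f :: "'a::euclidean_space \<Rightarrow> 'b::real_normed_vector"
  assumes "f differentiable (at x)"
  shows "frechet_derivative f (at x) h = (\<Sum>b\<in>Basis. (h \<bullet> b) *\<^sub>R frechet_derivative f (at x) b)"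
proof -
  have lin: "linear (frechet_derivative f (at x))"
    using assms linear_frechet_derivative by blast
  have "frechet_derivative f (at x) h = frechet_derivative f (at x) (\<Sum>b\<in>Basis. (h \<bullet> b) *\<^sub>R b)"
    by (simp add: euclidean_representation)
  then show ?thesis
    using lin by (simp add: linear_sum linear_scale)
qed

text \<open>
  The partial derivatives are continuous, hence bounded on \<open>S\<close>, and they bound the operator norm of
  the derivative; convexity of \<open>S\<close> allows the mean value inequality.
\<close>

lemma C_infinity_imp_lipschitz_on:
  fixes f :: "'a::euclidean_space \<Rightarrow> 'b::real_normed_vector"
  assumes f: "C_infinity f" and S: "compact S" "convex S"
  obtains L where "L-lipschitz_on S f"
proof -
  let ?D = "\<lambda>b x. frechet_derivative f (at x) b"
  have "\<exists>B\<ge>0. \<forall>x\<in>S. norm (?D b x) \<le> B" if "b \<in> Basis" for b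
  proof -
    have "bounded (?D b ` S)"
      using C_infinity_continuous[OF C_infinity_frechet_derivative[OF f that]] S(1)
      by (intro compact_imp_bounded compact_continuous_image)
    then obtain B where "\<forall>x\<in>S. norm (?D b x) \<le> B"
      unfolding bounded_iff by auto
    then show ?thesis
      by (intro exI[of _ "max B 0"]) (auto simp: le_max_iff_disj)
  qed
  then obtain B where B: "\<And>b. b \<in> Basis \<Longrightarrow> B b \<ge> 0"
    "\<And>b x. b \<in> Basis \<Longrightarrow> x \<in> S \<Longrightarrow> norm (?D b x) \<le> B b"
    by metis
  have "(sum B Basis)-lipschitz_on S f"
  proof (rule bounded_derivative_imp_lipschitz[where f' = "\<lambda>x. frechet_derivative f (at x)"])
    show "(f has_derivative frechet_derivative f (at x)) (at x within S)" for x
      using C_infinity_has_derivative[OF f] has_derivative_at_withinI by blast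
    show "onorm (frechet_derivative f (at x)) \<le> sum B Basis" if x: "x \<in> S" for x
    proof (rule onorm_le)
      fix h
      have "norm (frechet_derivative f (at x) h) = norm (\<Sum>b\<in>Basis. (h \<bullet> b) *\<^sub>R ?D b x)"
        by (simp only: frechet_derivative_basis_expansion[OF C_infinity_differentiable[OF f], of _ h])
      also have "\<dots> \<le> (\<Sum>b\<in>Basis. B b * norm h)"
      proof (rule sum_norm_le)
        fix b :: 'a assume b: "b \<in> Basis"
        have "norm ((h \<bullet> b) *\<^sub>R ?D b x) = \<bar>h \<bullet> b\<bar> * norm (?D b x)" by simp
        also have "\<dots> \<le> norm h * B b"
          using Basis_le_norm[OF b] B b x by (intro mult_mono) auto
        finally show "norm ((h \<bullet> b) *\<^sub>R ?D b x) \<le> B b * norm h" by (simp add: mult.commute)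
      qed
      finally show "norm (frechet_derivative f (at x) h) \<le> sum B Basis * norm h"
        by (simp add: sum_distrib_right)
    qed
  qed (use S B in \<open>auto intro: sum_nonneg\<close>)
  then show ?thesis using that by blast
qed

lemma lipschitz_on_scaleR_bounded:
  fixes f :: "'a::metric_space \<Rightarrow> 'b::real_normed_vector"
  assumes f: "L-lipschitz_on S f" and c: "M-lipschitz_on S c"
    and bf: "\<And>x. x \<in> S \<Longrightarrow> norm (f x) \<le> A" and bc: "\<And>x. x \<in> S \<Longrightarrow> \<bar>c x\<bar> \<le> B"
    and "A \<ge> 0" "B \<ge> 0"
  shows "(B * L + M * A)-lipschitz_on S (\<lambda>x. c x *\<^sub>R f x)"
proof (rule lipschitz_onI)
  have LM: "L \<ge> 0" "M \<ge> 0"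
    using f c lipschitz_on_nonneg by auto
  then show "0 \<le> B * L + M * A" using assms by auto
  fix x y assume xy: "x \<in> S" "y \<in> S"
  have "c x *\<^sub>R f x - c y *\<^sub>R f y = c x *\<^sub>R (f x - f y) + (c x - c y) *\<^sub>R f y"
    by (simp add: algebra_simps)
  then have "dist (c x *\<^sub>R f x) (c y *\<^sub>R f y) \<le> \<bar>c x\<bar> * dist (f x) (f y) + dist (c x) (c y) * norm (f y)"
    by (metis dist_norm norm_scaleR norm_triangle_ineq real_norm_def)
  also have "\<dots> \<le> B * (L * dist x y) + (M * dist x y) * A"
    using xy LM \<open>A \<ge> 0\<close> \<open>B \<ge> 0\<close>
    by (intro add_mono mult_mono bf bc lipschitz_onD[OF f] lipschitz_onD[OF c]) auto
  finally show "dist (c x *\<^sub>R f x) (c y *\<^sub>R f y) \<le> (B * L + M * A) * dist x y"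
    by (simp add: algebra_simps)
qed

lemma lipschitz_on_sum:
  fixes f :: "'i \<Rightarrow> 'a::metric_space \<Rightarrow> 'b::real_normed_vector"
  assumes "finite I" "\<And>i. i \<in> I \<Longrightarrow> (L i)-lipschitz_on S (f i)"
  shows "(sum L I)-lipschitz_on S (\<lambda>x. \<Sum>i\<in>I. f i x)"
  using assms
proof (induction I rule: finite_induct)
  case empty
  then show ?case using lipschitz_on_constant[of S 0] by simp
next
  case (insert i I)
  then show ?case using lipschitz_on_add by fastforce
qed

text \<open>
  The Euler derivative \<open>Df(x)[x]\<close> is the sum of the coordinates of \<open>x\<close> times the partial derivatives
  of \<open>f\<close>, hence a sum of products of bounded Lipschitz functions.
\<close>

lemma C_infinity_imp_lipschitz_on_euler_derivative:
  fixes f :: "'a::euclidean_space \<Rightarrow> 'b::real_normed_vector"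
  assumes f: "C_infinity f" and S: "compact S" "convex S"
  obtains L where "L-lipschitz_on S (\<lambda>x. frechet_derivative f (at x) x)"
proof -
  obtain B0 where "\<forall>x\<in>S. norm x \<le> B0"
    using compact_imp_bounded[OF S(1)] bounded_iff by blast
  then obtain B where B: "B \<ge> 0" "\<And>x. x \<in> S \<Longrightarrow> norm x \<le> B"
    by (metis max.cobounded1 max.coboundedI2)
  have "\<exists>L. L-lipschitz_on S (\<lambda>x. (x \<bullet> b) *\<^sub>R frechet_derivative f (at x) b)" if b: "b \<in> Basis" for b
  proof -
    let ?D = "\<lambda>x. frechet_derivative f (at x) b"
    have D: "C_infinity ?D" using C_infinity_frechet_derivative[OF f b] .
    then obtain L where L: "L-lipschitz_on S ?D"
      using C_infinity_imp_lipschitz_on S by metis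
    have "bounded (?D ` S)"
      using C_infinity_continuous[OF D] S(1)
      by (intro compact_imp_bounded compact_continuous_image)
    then obtain A0 where "\<forall>x\<in>S. norm (?D x) \<le> A0"
      unfolding bounded_iff by auto
    then obtain A where A: "A \<ge> 0" "\<And>x. x \<in> S \<Longrightarrow> norm (?D x) \<le> A"
      by (metis max.cobounded1 max.coboundedI2)
    have "1-lipschitz_on S (\<lambda>x. x \<bullet> b)"
    proof (rule lipschitz_onI)
      fix x y show "dist (x \<bullet> b) (y \<bullet> b) \<le> 1 * dist x y"
        using Basis_le_norm[OF b, of "x - y"] by (simp add: dist_norm inner_diff_left)
    qed simp
    moreover have "\<bar>x \<bullet> b\<bar> \<le> B" if "x \<in> S" for x
      using Basis_le_norm[OF b, of x] B(2)[OF that] by linarith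
    ultimately show ?thesis
      using lipschitz_on_scaleR_bounded[OF L _ A(2) _ A(1) B(1)] by blast
  qed
  then obtain L where "\<And>b. b \<in> Basis \<Longrightarrow>
      (L b)-lipschitz_on S (\<lambda>x. (x \<bullet> b) *\<^sub>R frechet_derivative f (at x) b)"
    by metis
  then have "(sum L Basis)-lipschitz_on S (\<lambda>x. \<Sum>b\<in>Basis. (x \<bullet> b) *\<^sub>R frechet_derivative f (at x) b)"
    by (rule lipschitz_on_sum[OF finite_Basis])
  moreover have "(\<lambda>x. \<Sum>b\<in>Basis. (x \<bullet> b) *\<^sub>R frechet_derivative f (at x) b) =
      (\<lambda>x. frechet_derivative f (at x) x)"
    using frechet_derivative_basis_expansion[OF C_infinity_differentiable[OF f], symmetric]
    by (rule ext)
  ultimately show ?thesis using that by metis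
qed

section \<open>Matrices and matrix-valued maps\<close>

lemma bounded_bilinear_matrix_vector_mult:
  "bounded_bilinear ((*v) :: real^'n^'m \<Rightarrow> real^'n \<Rightarrow> real^'m)"
proof -
  have "bilinear ((*v) :: real^'n^'m \<Rightarrow> real^'n \<Rightarrow> real^'m)"
    unfolding bilinear_def
    by (intro conjI allI matrix_vector_mul_linear linearI)
      (auto simp: matrix_vector_mult_add_rdistrib scaleR_matrix_vector_assoc)
  then show ?thesis
    by (simp add: bilinear_conv_bounded_bilinear)
qed

lemma inner_matrix_vector_eq_sum:
  fixes A :: "real^'n^'m"
  shows "v \<bullet> (A *v w) = (\<Sum>i\<in>UNIV. \<Sum>j\<in>UNIV. v $ i * A $ i $ j * w $ j)"
  by (simp add: inner_vec_def matrix_vector_mult_def sum_distrib_left mult.assoc)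

lemma inner_outer_product: "v \<bullet> (outer_product x x *v v) = (x \<bullet> v)\<^sup>2"
proof -
  have "outer_product x x *v v = (x \<bullet> v) *\<^sub>R x"
    by (simp add: vec_eq_iff outer_product_def matrix_vector_mult_def inner_vec_def
        sum_distrib_left mult.left_commute mult.commute)
  then show ?thesis by (simp add: power2_eq_square inner_commute)
qed

lemma scaleR_matrix_mult_left:
  fixes A :: "real^'n^'m" and B :: "real^'k^'n"
  shows "(c *\<^sub>R A) ** B = c *\<^sub>R (A ** B)"
  by (simp add: matrix_matrix_mult_def vec_eq_iff sum_distrib_left mult.assoc)

lemma matrix_inv_positive_definite:
  fixes A :: "real^'n^'n"
  assumes "\<And>v. v \<noteq> 0 \<Longrightarrow> v \<bullet> (A *v v) > 0"
  shows "A ** matrix_inv A = mat 1"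
proof -
  have "v = 0" if "A *v v = 0" for v
    using assms[of v] that by force
  then have "invertible A"
    by (simp add: invertible_left_inverse matrix_left_invertible_ker)
  then have "\<exists>B. A ** B = mat 1 \<and> B ** A = mat 1"
    by (simp add: invertible_def)
  then show ?thesis
    unfolding matrix_inv_def by (rule someI2_ex) simp
qed

lemma has_derivative_matrix_entry:
  assumes "(G has_derivative G') F"
  shows "((\<lambda>y. G y $ i $ j) has_derivative (\<lambda>h. G' h $ i $ j)) F"
  using assms by (intro bounded_linear.has_derivative[OF bounded_linear_vec_nth])

lemma frechet_derivative_matrix_entry:
  fixes G :: "real^'n \<Rightarrow> real^'n^'n"
  assumes "G differentiable (at x)"
  shows "frechet_derivative (\<lambda>y. G y $ i $ j) (at x) h = frechet_derivative G (at x) h $ i $ j"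
  using frechet_derivative_at[OF has_derivative_matrix_entry[OF
        assms[unfolded frechet_derivative_works]], symmetric]
  by (rule fun_cong)

lemma frechet_derivative_axis_expansion:
  fixes G :: "real^'n \<Rightarrow> 'b::real_normed_vector"
  assumes "G differentiable (at x)"
  shows "frechet_derivative G (at x) h = (\<Sum>i\<in>UNIV. (h $ i) *\<^sub>R frechet_derivative G (at x) (axis i 1))"
proof -
  have lin: "linear (frechet_derivative G (at x))"
    using assms linear_frechet_derivative by blast
  have "frechet_derivative G (at x) h = frechet_derivative G (at x) (\<Sum>i\<in>UNIV. (h $ i) *\<^sub>R axis i 1)"
    using basis_expansion[of h] by (simp add: scalar_mult_eq_scaleR)
  then show ?thesis
    using lin by (simp add: linear_sum linear_scale)
qed

section \<open>The radial acceleration of a geodesic\<close>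

text \<open>
  When \<open>x\<close> absorbs the inverse metric, the three partial derivatives in the Christoffel symbols
  remain, contracted once with \<open>x\<close> and twice with \<open>v\<close>. The first two contribute equally, because they
  are exchanged by swapping the two indices contracted with \<open>v\<close>; the third differentiates in the
  direction \<open>x\<close>.
\<close>

lemma inner_christoffel_contraction:
  fixes G :: "real^'n \<Rightarrow> real^'n^'n"
  assumes diff: "G differentiable (at x)"
    and x: "x v* matrix_inv (G x) = x"
  shows "(\<Sum>k\<in>UNIV. x $ k * (\<Sum>i\<in>UNIV. \<Sum>j\<in>UNIV. christoffel G k i j x * v $ i * v $ j)) =
     v \<bullet> (frechet_derivative G (at x) v *v x) - (1/2) * (v \<bullet> (frechet_derivative G (at x) x *v v))"
proof -
  define D where "D i = frechet_derivative G (at x) (axis i 1)" for i :: 'n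
  have p: "partial i (\<lambda>y. G y $ j $ l) x = D i $ j $ l" for i j l
    by (simp add: partial_def D_def frechet_derivative_matrix_entry[OF diff])
  have xg: "(\<Sum>k\<in>UNIV. x $ k * matrix_inv (G x) $ k $ l) = x $ l" for l
    using arg_cong[OF x, of "\<lambda>z. z $ l"] by (simp add: vector_matrix_mult_def mult.commute)
  have D: "frechet_derivative G (at x) h $ a $ b = (\<Sum>i\<in>UNIV. h $ i * D i $ a $ b)" for h a b
    by (subst frechet_derivative_axis_expansion[OF diff]) (simp add: D_def)
  define E where "E i j l = D i $ j $ l + D j $ i $ l - D l $ i $ j" for i j l
  \<comment> \<open>Contracting the upper index with \<open>x\<close> cancels the inverse metric.\<close>
  have sw: "(\<Sum>k\<in>UNIV. x $ k * (\<Sum>l\<in>UNIV. matrix_inv (G x) $ k $ l * f l)) = (\<Sum>l\<in>UNIV. x $ l * f l)"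
    for f :: "'n \<Rightarrow> real"
  proof -
    have "(\<Sum>k\<in>UNIV. x $ k * (\<Sum>l\<in>UNIV. matrix_inv (G x) $ k $ l * f l)) =
       (\<Sum>k\<in>UNIV. \<Sum>l\<in>UNIV. (x $ k * matrix_inv (G x) $ k $ l) * f l)"
      by (simp add: sum_distrib_left mult.assoc)
    also have "\<dots> = (\<Sum>l\<in>UNIV. \<Sum>k\<in>UNIV. (x $ k * matrix_inv (G x) $ k $ l) * f l)"
      by (rule sum.swap)
    also have "\<dots> = (\<Sum>l\<in>UNIV. x $ l * f l)"
      by (simp add: sum_distrib_right[symmetric] xg)
    finally show ?thesis .
  qed
  have chr: "(\<Sum>k\<in>UNIV. x $ k * christoffel G k i j x) = (1/2) * (\<Sum>l\<in>UNIV. x $ l * E i j l)" for i j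
  proof -
    have "(\<Sum>k\<in>UNIV. x $ k * christoffel G k i j x) =
       (1/2) * (\<Sum>k\<in>UNIV. x $ k * (\<Sum>l\<in>UNIV. matrix_inv (G x) $ k $ l * E i j l))"
      unfolding christoffel_def p E_def sum_distrib_left by (simp only: mult.left_commute mult.assoc)
    then show ?thesis by (simp only: sw)
  qed
  have T1: "(\<Sum>i\<in>UNIV. \<Sum>j\<in>UNIV. \<Sum>l\<in>UNIV. v $ i * D j $ i $ l * x $ l * v $ j) =
      v \<bullet> (frechet_derivative G (at x) v *v x)"
    unfolding inner_matrix_vector_eq_sum D sum_distrib_left sum_distrib_right
    by (rule sum.cong[OF refl], subst sum.swap, intro sum.cong refl) (simp add: algebra_simps)
  have T2: "(\<Sum>i\<in>UNIV. \<Sum>j\<in>UNIV. \<Sum>l\<in>UNIV. v $ i * D i $ j $ l * x $ l * v $ j) =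
      v \<bullet> (frechet_derivative G (at x) v *v x)"
    unfolding T1[symmetric]
    by (subst sum.swap) (intro sum.cong refl, simp add: algebra_simps)
  have T3: "(\<Sum>i\<in>UNIV. \<Sum>j\<in>UNIV. \<Sum>l\<in>UNIV. v $ i * D l $ i $ j * x $ l * v $ j) =
      v \<bullet> (frechet_derivative G (at x) x *v v)"
    unfolding inner_matrix_vector_eq_sum D sum_distrib_left sum_distrib_right
    by (intro sum.cong refl) (simp add: algebra_simps)
  have "(\<Sum>k\<in>UNIV. x $ k * (\<Sum>i\<in>UNIV. \<Sum>j\<in>UNIV. christoffel G k i j x * v $ i * v $ j)) =
      (\<Sum>k\<in>UNIV. \<Sum>i\<in>UNIV. \<Sum>j\<in>UNIV. x $ k * christoffel G k i j x * v $ i * v $ j)"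
    by (simp add: sum_distrib_left mult.assoc)
  also have "\<dots> = (\<Sum>i\<in>UNIV. \<Sum>k\<in>UNIV. \<Sum>j\<in>UNIV. x $ k * christoffel G k i j x * v $ i * v $ j)"
    by (rule sum.swap)
  also have "\<dots> = (\<Sum>i\<in>UNIV. \<Sum>j\<in>UNIV. \<Sum>k\<in>UNIV. x $ k * christoffel G k i j x * v $ i * v $ j)"
    by (intro sum.cong refl sum.swap)
  also have "\<dots> = (\<Sum>i\<in>UNIV. \<Sum>j\<in>UNIV. (1/2) * (\<Sum>l\<in>UNIV. x $ l * E i j l) * v $ i * v $ j)"
    by (simp only: sum_distrib_right[symmetric] chr)
  also have "\<dots> = (1/2) * (\<Sum>i\<in>UNIV. \<Sum>j\<in>UNIV. \<Sum>l\<in>UNIV. v $ i * D i $ j $ l * x $ l * v $ j)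
      + (1/2) * (\<Sum>i\<in>UNIV. \<Sum>j\<in>UNIV. \<Sum>l\<in>UNIV. v $ i * D j $ i $ l * x $ l * v $ j)
      - (1/2) * (\<Sum>i\<in>UNIV. \<Sum>j\<in>UNIV. \<Sum>l\<in>UNIV. v $ i * D l $ i $ j * x $ l * v $ j)"
    unfolding E_def sum_distrib_left sum_distrib_right sum.distrib[symmetric] sum_subtractf[symmetric]
    by (intro sum.cong refl) (simp add: algebra_simps)
  also have "\<dots> = v \<bullet> (frechet_derivative G (at x) v *v x)
      - (1/2) * (v \<bullet> (frechet_derivative G (at x) x *v v))"
    by (simp add: T1 T2 T3)
  finally show ?thesis .
qed

text \<open>
  Differentiating \<open>G(y) y = y\<close> at \<open>x\<close> in the direction \<open>v\<close> gives \<open>DG(x)[v] x + G(x) v = v\<close>.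
\<close>

lemma derivative_radial_eigenvector:
  fixes G :: "real^'n \<Rightarrow> real^'n^'n"
  assumes diff: "G differentiable (at x)" and S: "open S" "x \<in> S" "\<And>y. y \<in> S \<Longrightarrow> G y *v y = y"
  shows "frechet_derivative G (at x) v *v x = v - G x *v v"
proof -
  have "((\<lambda>y. G y *v y) has_derivative
      (\<lambda>h. G x *v h + frechet_derivative G (at x) h *v x)) (at x)"
    using bounded_bilinear.FDERIV[OF bounded_bilinear_matrix_vector_mult
        diff[unfolded frechet_derivative_works] has_derivative_ident] .
  moreover have "((\<lambda>y. G y *v y) has_derivative (\<lambda>h. h)) (at x)"
    by (rule has_derivative_transform_within_open[OF has_derivative_ident S(1,2)])
      (simp add: S(3))
  ultimately have "(\<lambda>h. G x *v h + frechet_derivative G (at x) h *v x) = (\<lambda>h. h)"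
    by (rule has_derivative_unique)
  then have "G x *v v + frechet_derivative G (at x) v *v x = v" by metis
  then show ?thesis by (simp add: algebra_simps)
qed

text \<open>
  For a geodesic through \<open>x\<close> with velocity \<open>v\<close> the left-hand side is the second derivative of half the
  squared Euclidean distance to the origin. The right-hand side contains derivatives of \<open>G\<close> in the
  radial direction only.
\<close>

lemma radial_acceleration:
  fixes G :: "real^'n \<Rightarrow> real^'n^'n"
  assumes G: "riemannian_metric G" and S: "open S" "x \<in> S" "\<And>y. y \<in> S \<Longrightarrow> G y *v y = y"
  shows "v \<bullet> v - (\<Sum>k\<in>UNIV. x $ k * (\<Sum>i\<in>UNIV. \<Sum>j\<in>UNIV. christoffel G k i j x * v $ i * v $ j))
    = v \<bullet> ((G x + (1/2) *\<^sub>R frechet_derivative G (at x) x) *v v)"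
proof -
  have diff: "G differentiable (at x)"
    using G by (simp add: riemannian_metric_def C_infinity_differentiable)
  have sym: "\<And>y. transpose (G y) = G y" using G by (simp add: riemannian_metric_def)
  have "x v* G x = x"
    using S sym transpose_matrix_vector[of "G x" x] by metis
  then have "x v* matrix_inv (G x) = x v* (G x ** matrix_inv (G x))"
    by (metis vector_matrix_mul_assoc)
  also have "\<dots> = x"
    using matrix_inv_positive_definite[of "G x"] G by (simp add: riemannian_metric_def)
  finally have xg: "x v* matrix_inv (G x) = x" .
  have "frechet_derivative G (at x) v *v x = v - G x *v v"
    by (rule derivative_radial_eigenvector[OF diff S(1,2)]) (rule S(3))
  then show ?thesis
    unfolding inner_christoffel_contraction[OF diff xg]
    by (simp add: inner_diff_right inner_add_right matrix_vector_mult_add_rdistrib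
        scaleR_matrix_vector_assoc[symmetric])
qed

text \<open>
  As \<open>x\<close> is a left eigenvector of \<open>G(x)\<close>, multiplying \<open>x \<otimes> x\<close> by \<open>G(x)\<close> leaves it unchanged. Thus
  half the derivative in the direction \<open>x\<close> is \<open>x \<otimes> x / R\<^sup>2 - G(x)\<close>, which cancels \<open>G(x)\<close>.
\<close>

lemma metric_plus_half_euler_derivative_on_sphere:
  fixes G :: "real^'n \<Rightarrow> real^'n^'n"
  assumes G: "riemannian_metric G" and R: "norm x = R" "R > 0"
    and fix_x: "G x *v x = x"
    and rad: "radial_derivative G x =
             (- (2 / R)) *\<^sub>R ((mat 1 - (1 / (norm x)\<^sup>2) *\<^sub>R outer_product x x) ** G x)"
  shows "G x + (1/2) *\<^sub>R frechet_derivative G (at x) x = (1 / R\<^sup>2) *\<^sub>R outer_product x x"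
proof -
  have diff: "G differentiable (at x)"
    using G by (simp add: riemannian_metric_def C_infinity_differentiable)
  have "transpose (G x) = G x" using G by (simp add: riemannian_metric_def)
  then have "x v* G x = x"
    using fix_x transpose_matrix_vector[of "G x" x] by metis
  then have col: "(\<Sum>k\<in>UNIV. x $ k * G x $ k $ j) = x $ j" for j
    by (metis (no_types, lifting) sum.cong vector_matrix_mult_def vec_lambda_beta)
  have matrix_diff_rdistrib: "(A - B) ** M = A ** M - B ** M" for A B M :: "real^'n^'n"
    by (simp add: vec_eq_iff matrix_matrix_mult_def left_diff_distrib sum_subtractf)
  have PG: "outer_product x x ** G x = outer_product x x"
    by (simp add: vec_eq_iff outer_product_def matrix_matrix_mult_def mult.assoc
        sum_distrib_left[symmetric] col)
  have lin: "linear (frechet_derivative G (at x))"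
    using diff linear_frechet_derivative by blast
  have "frechet_derivative G (at x) x = frechet_derivative G (at x) (R *\<^sub>R radial x)"
    using R by (simp add: radial_def)
  also have "\<dots> = R *\<^sub>R frechet_derivative G (at x) (radial x)"
    using lin by (simp add: linear_scale)
  also have "frechet_derivative G (at x) (radial x) = radial_derivative G x"
    by (simp add: vec_eq_iff radial_derivative_def frechet_derivative_matrix_entry[OF diff])
  also have "R *\<^sub>R radial_derivative G x =
      (- 2) *\<^sub>R (G x - (1 / R\<^sup>2) *\<^sub>R outer_product x x)"
    using R by (simp add: rad matrix_diff_rdistrib scaleR_matrix_mult_left PG)
  finally show ?thesis by (simp add: scaleR_diff_right)
qed

text \<open>
  The subtracted term is the quadratic form at the point of the sphere on the same ray as \<open>x\<close>. So the
  difference is controlled by the Lipschitz constant of the matrix field and the distance of \<open>x\<close> to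
  that point, which is \<open>|norm x - R|\<close>.
\<close>

lemma radial_acceleration_near_sphere:
  fixes G :: "real^'n \<Rightarrow> real^'n^'n"
  assumes G: "riemannian_metric G" and "R > 0"
    and sph: "\<And>x. norm x = R \<Longrightarrow>
        G x + (1/2) *\<^sub>R frechet_derivative G (at x) x = (1 / R\<^sup>2) *\<^sub>R outer_product x x"
  obtains C where "C \<ge> 0"
    "\<And>x v. x \<noteq> 0 \<Longrightarrow> norm x \<le> R + 1 \<Longrightarrow>
       \<bar>v \<bullet> ((G x + (1/2) *\<^sub>R frechet_derivative G (at x) x) *v v) - (x \<bullet> v)\<^sup>2 / (norm x)\<^sup>2\<bar>
         \<le> C * \<bar>norm x - R\<bar> * (norm v)\<^sup>2"
proof -
  let ?N = "\<lambda>x. G x + (1/2) *\<^sub>R frechet_derivative G (at x) x"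
  have smooth: "C_infinity G" using G by (simp add: riemannian_metric_def)
  obtain L1 where "L1-lipschitz_on (cball 0 (R + 1)) G"
    using C_infinity_imp_lipschitz_on[OF smooth compact_cball convex_cball] .
  moreover obtain L2 where "L2-lipschitz_on (cball 0 (R + 1)) (\<lambda>x. frechet_derivative G (at x) x)"
    using C_infinity_imp_lipschitz_on_euler_derivative[OF smooth compact_cball convex_cball] .
  ultimately have "(L1 + \<bar>1/2\<bar> * L2)-lipschitz_on (cball 0 (R + 1)) ?N"
    by (intro lipschitz_on_add lipschitz_on_cmult)
  then obtain L where L: "L-lipschitz_on (cball 0 (R + 1)) ?N" ..
  obtain K where K: "K > 0" "\<And>(A::real^'n^'n) v. norm (A *v v) \<le> norm A * norm v * K"
    using bounded_bilinear.pos_bounded[OF bounded_bilinear_matrix_vector_mult] by metis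
  show ?thesis
  proof (rule that)
    show "L * K \<ge> 0" using lipschitz_on_nonneg[OF L] K(1) by simp
    fix x v :: "real^'n" assume x: "x \<noteq> 0" "norm x \<le> R + 1"
    define p where "p = (R / norm x) *\<^sub>R x"
    have np: "norm p = R" using x \<open>R > 0\<close> by (simp add: p_def)
    have "x - p = (1 - R / norm x) *\<^sub>R x" by (simp add: p_def scaleR_diff_left)
    then have "norm (x - p) = \<bar>1 - R / norm x\<bar> * \<bar>norm x\<bar>" by simp
    also have "\<dots> = \<bar>norm x - R\<bar>"
      using x by (simp add: abs_mult[symmetric] field_simps)
    finally have xp: "norm (x - p) = \<bar>norm x - R\<bar>" .
    have "p \<bullet> v = R / norm x * (x \<bullet> v)" by (simp add: p_def)
    then have q: "v \<bullet> (?N p *v v) = (x \<bullet> v)\<^sup>2 / (norm x)\<^sup>2"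
      using \<open>R > 0\<close> unfolding sph[OF np]
      by (simp add: scaleR_matrix_vector_assoc[symmetric] inner_outer_product power_mult_distrib power_divide)
    have "norm (?N x - ?N p) \<le> L * norm (x - p)"
      using lipschitz_on_normD[OF L] x np by simp
    have "\<bar>v \<bullet> (?N x *v v) - (x \<bullet> v)\<^sup>2 / (norm x)\<^sup>2\<bar> = \<bar>v \<bullet> ((?N x - ?N p) *v v)\<bar>"
      unfolding q[symmetric] by (simp only: matrix_vector_mult_diff_rdistrib inner_diff_right)
    also have "\<dots> \<le> norm v * norm ((?N x - ?N p) *v v)"
      by (rule Cauchy_Schwarz_ineq2)
    also have "\<dots> \<le> norm v * (norm (?N x - ?N p) * norm v * K)"
      by (intro mult_left_mono K) simp
    also have "\<dots> \<le> norm v * ((L * norm (x - p)) * norm v * K)"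
      using \<open>norm (?N x - ?N p) \<le> L * norm (x - p)\<close> K(1)
      by (intro mult_left_mono mult_right_mono) auto
    also have "\<dots> = L * K * \<bar>norm x - R\<bar> * (norm v)\<^sup>2"
      unfolding xp by (simp add: power2_eq_square)
    finally show "\<bar>v \<bullet> (?N x *v v) - (x \<bullet> v)\<^sup>2 / (norm x)\<^sup>2\<bar> \<le> L * K * \<bar>norm x - R\<bar> * (norm v)\<^sup>2" .
  qed
qed

text \<open>
  A velocity of a curve on the sphere is orthogonal to the position, since \<open>c \<bullet> c\<close> is constant along
  the curve.
\<close>

lemma tangent_space_sphere_orthogonal:
  assumes "v \<in> tangent_space (sphere 0 R) x"
  shows "x \<bullet> v = 0"
proof -
  obtain c where c: "C_infinity c" "\<And>t. c t \<in> sphere 0 R" "c 0 = x" and v: "v = velocity UNIV c 0"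
    using assms unfolding tangent_space_def by blast
  have "c differentiable (at 0)"
    using C_infinity_differentiable[OF c(1)] .
  then have "(c has_vector_derivative v) (at 0)"
    unfolding v velocity_def by (simp add: vector_derivative_works)
  then have "((\<lambda>t. c t \<bullet> c t) has_real_derivative (c 0 \<bullet> v + v \<bullet> c 0)) (at 0)"
    unfolding has_real_derivative_iff_has_vector_derivative
    by (intro bounded_bilinear.has_vector_derivative[OF bounded_bilinear_inner])
  moreover have "(\<lambda>t. c t \<bullet> c t) = (\<lambda>t. R\<^sup>2)"
    using c(2) by (auto simp: power2_norm_eq_inner[symmetric])
  ultimately have "c 0 \<bullet> v + v \<bullet> c 0 = 0"
    using DERIV_unique[OF _ DERIV_const] by simp
  then show ?thesis using c(3) by (simp add: inner_commute)
qed

section \<open>Gronwall's argument\<close>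

text \<open>
  The function \<open>u(t) exp(- K t)\<close> is nonincreasing, starts at \<open>0\<close> and is nonnegative, hence
  stays \<open>0\<close>.
\<close>

lemma gronwall_zero_local:
  fixes u :: "real \<Rightarrow> real"
  assumes "a \<le> b" "u a = 0" "\<And>t. u t \<ge> 0" "continuous_on {a..b} u"
    and "\<And>t. a < t \<Longrightarrow> t < b \<Longrightarrow> \<exists>d. (u has_real_derivative d) (at t) \<and> d \<le> K * u t"
  shows "u b = 0"
proof -
  have "u a * exp (- K * a) \<ge> u b * exp (- K * b)"
  proof (rule DERIV_nonpos_imp_decreasing_open[OF \<open>a \<le> b\<close>])
    fix t assume "a < t" "t < b"
    then obtain d where d: "(u has_real_derivative d) (at t)" "d \<le> K * u t"
      using assms(5) by blast
    show "\<exists>y. ((\<lambda>t. u t * exp (- K * t)) has_real_derivative y) (at t) \<and> y \<le> 0"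
    proof (intro exI conjI)
      show "((\<lambda>t. u t * exp (- K * t)) has_real_derivative (d - K * u t) * exp (- K * t)) (at t)"
        by (auto intro!: derivative_eq_intros d(1) simp: algebra_simps)
      show "(d - K * u t) * exp (- K * t) \<le> 0"
        using d(2) by (simp add: mult_nonpos_nonneg)
    qed
  qed (use assms(4) in \<open>intro continuous_intros\<close>)
  then have "u b * exp (- K * b) \<le> 0" using assms(2) by simp
  then have "u b \<le> 0" by (simp add: mult_le_0_iff)
  then show ?thesis using assms(3)[of b] by simp
qed

text \<open>
  The differential inequality is required only shortly after each zero of \<open>u\<close>, with a constant that may
  depend on the zero. For a geodesic this is what is available: the estimate holds close to the
  sphere, and its constant involves a local bound on the velocity. If \<open>u\<close> vanishes up to a maximal time,
  continuity makes that time a zero of \<open>u\<close>, from which the inequality extends the vanishing further.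
\<close>

lemma gronwall_zero:
  fixes u :: "real \<Rightarrow> real"
  assumes u0: "u 0 = 0" and nn: "\<And>t. u t \<ge> 0" and cont: "continuous_on {0..} u"
    and loc: "\<And>a. a \<ge> 0 \<Longrightarrow> u a = 0 \<Longrightarrow> \<exists>\<delta>>0. \<exists>K. \<forall>t. a < t \<and> t < a + \<delta> \<longrightarrow>
        (\<exists>d. (u has_real_derivative d) (at t) \<and> d \<le> K * u t)"
    and "t \<ge> 0"
  shows "u t = 0"
proof (rule ccontr)
  assume ut: "u t \<noteq> 0"
  \<comment> \<open>The right endpoints of the initial segments on which \<open>u\<close> vanishes.\<close>
  define Z where "Z = {s \<in> {0..t}. \<forall>r\<in>{0..s}. u r = 0}"
  define a where "a = Sup Z"
  have Z0: "0 \<in> Z" using u0 \<open>t \<ge> 0\<close> by (auto simp: Z_def)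
  have bdd: "bdd_above Z" by (auto simp: Z_def bdd_above_def)
  have a0: "a \<ge> 0"
    unfolding a_def by (rule cSup_upper[OF Z0 bdd])
  have at_le: "a \<le> t"
    unfolding a_def by (rule cSup_least) (use Z0 in blast, simp add: Z_def)
  note a = a0 at_le
  have below: "u r = 0" if r: "0 \<le> r" "r < a" for r
  proof -
    obtain s where "s \<in> Z" "r < s"
      using less_cSupD[of Z r] r Z0 unfolding a_def by blast
    then show ?thesis using r by (auto simp: Z_def)
  qed
  have ua: "u a = 0"
  proof (cases "a = 0")
    case False
    have "continuous_on {0..a} u" using cont continuous_on_subset by fastforce
    moreover have "closure {0..<a} = {0..a}" using False a by simp
    ultimately show ?thesis
      using continuous_constant_on_closure[of "{0..<a}" u 0 a] below False a by auto
  qed (use u0 in simp)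
  obtain \<delta> K where \<delta>: "\<delta> > 0" and K: "\<And>t. a < t \<Longrightarrow> t < a + \<delta> \<Longrightarrow>
      \<exists>d. (u has_real_derivative d) (at t) \<and> d \<le> K * u t"
    using loc[OF a(1) ua] by blast
  have above: "u r = 0" if r: "a \<le> r" "r < a + \<delta>" for r
  proof (rule gronwall_zero_local[where a = a and b = r and K = K])
    show "continuous_on {a..r} u" using cont a by (auto intro: continuous_on_subset)
  qed (use r K ua nn in auto)
  have at: "a < t" using a ua ut by (cases "a = t") auto
  define s where "s = min t (a + \<delta>/2)"
  have s: "s \<le> t" "0 \<le> s" "s < a + \<delta>"
    using at a \<delta> by (auto simp: s_def)
  have "u r = 0" if "0 \<le> r" "r \<le> s" for r
    using below[of r] above[of r] that s by (cases "r < a") auto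
  then have "s \<in> Z"
    using s by (simp add: Z_def)
  then have "s \<le> a" unfolding a_def by (rule cSup_upper[OF _ bdd])
  then show False using at \<delta> by (auto simp: s_def)
qed

text \<open>
  The left-hand side is the derivative of \<open>e\<^sup>2 + w\<^sup>2\<close> when \<open>w\<close> is the derivative of \<open>e\<close> and \<open>w'\<close> that of \<open>w\<close>.
  The mixed term is absorbed by \<open>2 |e| |w| \<le> e\<^sup>2 + w\<^sup>2\<close>.
\<close>

lemma deviation_derivative_bound:
  fixes e w :: real
  assumes "\<bar>w'\<bar> \<le> A * \<bar>e\<bar> + B * \<bar>w\<bar>" "A \<ge> 0" "B \<ge> 0"
  shows "2 * e * w + 2 * w * w' \<le> (1 + A + 2 * B) * (e\<^sup>2 + w\<^sup>2)"
proof -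
  have am: "2 * (\<bar>e\<bar> * \<bar>w\<bar>) \<le> e\<^sup>2 + w\<^sup>2"
    using sum_squares_bound[of "\<bar>e\<bar>" "\<bar>w\<bar>"] by simp
  have "e * w \<le> \<bar>e\<bar> * \<bar>w\<bar>" by (metis abs_ge_self abs_mult)
  moreover have "w * w' \<le> \<bar>w\<bar> * (A * \<bar>e\<bar> + B * \<bar>w\<bar>)"
    using assms(1) by (metis abs_ge_self abs_ge_zero abs_mult mult_left_mono order_trans)
  ultimately have "2 * e * w + 2 * w * w' \<le> (1 + A) * (2 * (\<bar>e\<bar> * \<bar>w\<bar>)) + 2 * B * w\<^sup>2"
    by (simp add: algebra_simps power2_eq_square)
  also have "\<dots> \<le> (1 + A) * (e\<^sup>2 + w\<^sup>2) + 2 * B * (e\<^sup>2 + w\<^sup>2)"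
    using am assms(2,3) by (intro add_mono mult_left_mono) auto
  finally show ?thesis by (simp add: algebra_simps)
qed

section \<open>Geodesics tangent to the sphere\<close>

theorem theorem1p4:
  fixes G :: "real^'n \<Rightarrow> real^'n^'n" and r_c R0 :: real
  assumes "CARD('n) \<ge> 2"
    and "riemannian_metric G"
    and "complete_metric G"
    and "r_c > 0"
    and "\<And>x. norm x \<ge> r_c \<Longrightarrow> G x *v radial x = radial x"
    and "R0 > r_c"
    and "\<And>x. norm x = R0 \<Longrightarrow>
           radial_derivative G x =
             (- (2 / R0)) *\<^sub>R ((mat 1 - (1 / (norm x)\<^sup>2) *\<^sub>R outer_product x x) ** G x)"
  shows "\<forall>x \<in> sphere 0 R0. \<forall>\<gamma>.
           geodesic_on G {0..} \<gamma> \<and> unit_speed_on G {0..} \<gamma> \<and> \<gamma> 0 = x \<and>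
           velocity {0..} \<gamma> 0 \<in> tangent_space (sphere 0 R0) x
           \<longrightarrow> (\<forall>t\<ge>0. \<gamma> t \<in> sphere 0 R0)"
proof (intro ballI allI impI, elim conjE)
  fix x \<gamma> and t :: real
  assume x: "x \<in> sphere 0 R0" and geo: "geodesic_on G {0..} \<gamma>" and \<gamma>0: "\<gamma> 0 = x"
    and tan: "velocity {0..} \<gamma> 0 \<in> tangent_space (sphere 0 R0) x" and t: "t \<ge> 0"
  note G = assms(2) and rc = assms(4) and R = assms(6)
  have R0: "R0 > 0" using rc R by simp
  have fixed: "G y *v y = y" if y: "norm y \<ge> r_c" for y
  proof -
    have y0: "norm y \<noteq> 0" using y rc by linarith
    then have "G y *v y = norm y *\<^sub>R (G y *v radial y)"
      by (simp add: radial_def matrix_vector_mult_scaleR)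
    also have "\<dots> = y" using assms(5)[OF y] y0 by (simp add: radial_def)
    finally show ?thesis .
  qed
  let ?N = "\<lambda>x. G x + (1/2) *\<^sub>R frechet_derivative G (at x) x"
  have sph: "?N y = (1 / R0\<^sup>2) *\<^sub>R outer_product y y" if y: "norm y = R0" for y
    using metric_plus_half_euler_derivative_on_sphere[OF G y R0 fixed assms(7)[OF y]] y R by simp
  obtain C where C: "C \<ge> 0" "\<And>x v. x \<noteq> 0 \<Longrightarrow> norm x \<le> R0 + 1 \<Longrightarrow>
       \<bar>v \<bullet> (?N x *v v) - (x \<bullet> v)\<^sup>2 / (norm x)\<^sup>2\<bar> \<le> C * \<bar>norm x - R0\<bar> * (norm v)\<^sup>2"
    using radial_acceleration_near_sphere[OF G R0 sph] by blast

  define v where "v = velocity {0..} \<gamma>"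
  define a where "a = velocity {0..} v"
  have d\<gamma>: "(\<gamma> has_vector_derivative v s) (at s within {0..})" if "s \<ge> 0" for s
    using geo that unfolding geodesic_on_def v_def velocity_def by (simp add: vector_derivative_works)
  have dv: "(v has_vector_derivative a s) (at s within {0..})" if "s \<ge> 0" for s
    using geo that unfolding geodesic_on_def a_def v_def velocity_def[of _ "velocity {0..} \<gamma>"]
    by (simp add: vector_derivative_works)
  have c\<gamma>: "continuous_on {0..} \<gamma>" and cv: "continuous_on {0..} v"
    using d\<gamma> dv has_vector_derivative_continuous continuous_on_eq_continuous_within by (metis atLeast_iff)+

  \<comment> \<open>The deviation from the sphere and its derivative \<open>w\<close>; both vanish together exactly when the
    curve is on the sphere and moves tangentially to it.\<close>
  define e where "e s = ((norm (\<gamma> s))\<^sup>2 - R0\<^sup>2) / 2" for s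
  define w where "w s = \<gamma> s \<bullet> v s" for s
  define u where "u s = (e s)\<^sup>2 + (w s)\<^sup>2" for s
  have acc: "v s \<bullet> v s + \<gamma> s \<bullet> a s = v s \<bullet> (?N (\<gamma> s) *v v s)"
    if s: "s \<ge> 0" and far: "norm (\<gamma> s) > r_c" for s
  proof -
    have "a s $ k = - (\<Sum>i\<in>UNIV. \<Sum>j\<in>UNIV. christoffel G k i j (\<gamma> s) * v s $ i * v s $ j)" for k
      using geo s unfolding geodesic_on_def a_def v_def by (simp add: eq_neg_iff_add_eq_0)
    then have "\<gamma> s \<bullet> a s = - (\<Sum>k\<in>UNIV. \<gamma> s $ k *
        (\<Sum>i\<in>UNIV. \<Sum>j\<in>UNIV. christoffel G k i j (\<gamma> s) * v s $ i * v s $ j))"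
      by (simp add: inner_vec_def sum_negf)
    moreover have "open {y::real^'n. r_c < norm y}"
      by (intro open_Collect_less continuous_intros)
    ultimately show ?thesis
      using radial_acceleration[OF G, of "{y. r_c < norm y}" "\<gamma> s" "v s"] far fixed by simp
  qed
  have "u t = 0"
  proof (rule gronwall_zero[OF _ _ _ _ t])
    show "u 0 = 0"
      using x \<gamma>0 tangent_space_sphere_orthogonal[OF tan] by (simp add: u_def e_def w_def v_def)
    show "u s \<ge> 0" for s by (simp add: u_def)
    show "continuous_on {0..} u"
      unfolding u_def e_def w_def by (intro continuous_intros c\<gamma> cv) auto
    fix b :: real assume b: "b \<ge> 0" "u b = 0"
    then have "e b = 0" by (simp add: u_def add_nonneg_eq_0_iff)
    then have nb: "norm (\<gamma> b) = R0" using R0 by (simp add: e_def)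
    define V where "V = norm (v b) + 1"
    have V: "V > 0" by (simp add: V_def add_nonneg_pos)
    have "((\<lambda>s. norm (\<gamma> s)) \<longlongrightarrow> R0) (at b within {0..})" "((\<lambda>s. norm (v s)) \<longlongrightarrow> norm (v b)) (at b within {0..})"
      using c\<gamma> cv b(1) nb by (auto simp: continuous_on_def intro!: tendsto_eq_intros)
    then have "\<forall>\<^sub>F s in at b within {0..}. r_c < norm (\<gamma> s) \<and> norm (\<gamma> s) < R0 + 1 \<and> norm (v s) < V"
      using R by (intro eventually_conj) (auto simp: V_def intro: order_tendstoD)
    then obtain \<delta> where \<delta>: "\<delta> > 0" and near: "\<And>s. s \<ge> 0 \<Longrightarrow> s \<noteq> b \<Longrightarrow> dist s b < \<delta> \<Longrightarrow>
        r_c < norm (\<gamma> s) \<and> norm (\<gamma> s) < R0 + 1 \<and> norm (v s) < V"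
      unfolding eventually_at by auto
    \<comment> \<open>\<open>A\<close> converts the bound in \<open>|norm (\<gamma> s) - R0|\<close> to one in \<open>|e s|\<close>; \<open>B\<close> makes \<open>(w s)\<^sup>2\<close> linear in \<open>|w s|\<close>.\<close>
    define A where "A = 2 * C * V\<^sup>2 / R0"
    define B where "B = V / r_c"
    have "\<exists>d. (u has_real_derivative d) (at s) \<and> d \<le> (1 + A + 2 * B) * u s"
      if s: "b < s" "s < b + \<delta>" for s
    proof (intro exI conjI)
      have s0: "s > 0" using s b by simp
      have at: "at s within {0..} = at s"
        using s0 by (intro at_within_interior) simp
      have n: "r_c < norm (\<gamma> s)" "norm (\<gamma> s) < R0 + 1" "norm (v s) < V"
        using near[of s] s s0 by (auto simp: dist_real_def)
      have d1: "(\<gamma> has_vector_derivative v s) (at s)" and d2: "(v has_vector_derivative a s) (at s)"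
        using d\<gamma>[of s] dv[of s] s0 at by auto
      have "(e has_real_derivative w s) (at s)"
        unfolding e_def[abs_def] power2_norm_eq_inner
        using bounded_bilinear.has_vector_derivative[OF bounded_bilinear_inner d1 d1]
        by (auto intro!: derivative_eq_intros
            simp: has_real_derivative_iff_has_vector_derivative[symmetric] w_def inner_commute)
      moreover have "(w has_real_derivative (v s \<bullet> v s + \<gamma> s \<bullet> a s)) (at s)"
        unfolding w_def[abs_def]
        using bounded_bilinear.has_vector_derivative[OF bounded_bilinear_inner d1 d2]
        by (simp add: has_real_derivative_iff_has_vector_derivative add.commute)
      ultimately show "(u has_real_derivative
          (2 * e s * w s + 2 * w s * (v s \<bullet> v s + \<gamma> s \<bullet> a s))) (at s)"
        unfolding u_def[abs_def] by (auto intro!: derivative_eq_intros)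
      have "\<bar>norm (\<gamma> s) - R0\<bar> * R0 \<le> \<bar>norm (\<gamma> s) - R0\<bar> * (norm (\<gamma> s) + R0)"
        by (intro mult_left_mono) auto
      also have "\<dots> = \<bar>(norm (\<gamma> s) - R0) * (norm (\<gamma> s) + R0)\<bar>"
        using R0 by (simp add: abs_mult)
      also have "\<dots> = 2 * \<bar>e s\<bar>" by (simp add: e_def power2_eq_square algebra_simps)
      finally have dist_e: "\<bar>norm (\<gamma> s) - R0\<bar> \<le> 2 * \<bar>e s\<bar> / R0"
        using R0 by (simp add: field_simps)
      have "C * \<bar>norm (\<gamma> s) - R0\<bar> * (norm (v s))\<^sup>2 \<le> C * (2 * \<bar>e s\<bar> / R0) * V\<^sup>2"
        using dist_e n C(1) R0 by (intro mult_mono power_mono) auto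
      also have "\<dots> = A * \<bar>e s\<bar>" by (simp add: A_def)
      finally have near_sphere: "C * \<bar>norm (\<gamma> s) - R0\<bar> * (norm (v s))\<^sup>2 \<le> A * \<bar>e s\<bar>" .
      have g0: "norm (\<gamma> s) > 0" using n rc by linarith
      have "\<bar>w s\<bar> \<le> norm (\<gamma> s) * V"
        using Cauchy_Schwarz_ineq2[of "\<gamma> s" "v s"] n(3) unfolding w_def
        by (meson less_imp_le mult_left_mono norm_ge_zero order_trans)
      then have "\<bar>w s\<bar> * \<bar>w s\<bar> \<le> (norm (\<gamma> s) * V) * \<bar>w s\<bar>"
        by (intro mult_right_mono) auto
      then have "(w s)\<^sup>2 / (norm (\<gamma> s))\<^sup>2 \<le> V / norm (\<gamma> s) * \<bar>w s\<bar>"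
        using g0 by (simp add: field_simps power2_eq_square)
      also have "\<dots> \<le> B * \<bar>w s\<bar>"
        unfolding B_def using n(1) rc V g0 by (intro mult_right_mono divide_left_mono) auto
      finally have radial_part: "(w s)\<^sup>2 / (norm (\<gamma> s))\<^sup>2 \<le> B * \<bar>w s\<bar>" .
      have "\<bar>v s \<bullet> v s + \<gamma> s \<bullet> a s\<bar> \<le> A * \<bar>e s\<bar> + B * \<bar>w s\<bar>"
      proof -
        have "\<bar>v s \<bullet> (?N (\<gamma> s) *v v s) - (w s)\<^sup>2 / (norm (\<gamma> s))\<^sup>2\<bar> \<le> A * \<bar>e s\<bar>"
          using C(2)[of "\<gamma> s" "v s"] near_sphere g0 n(2) unfolding w_def by simp
        moreover have "(w s)\<^sup>2 / (norm (\<gamma> s))\<^sup>2 \<ge> 0" by simp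
        ultimately show ?thesis
          using acc[of s] s0 n(1) radial_part by linarith
      qed
      then show "2 * e s * w s + 2 * w s * (v s \<bullet> v s + \<gamma> s \<bullet> a s) \<le> (1 + A + 2 * B) * u s"
        unfolding u_def
        by (rule deviation_derivative_bound) (use C(1) R0 V rc in \<open>simp_all add: A_def B_def\<close>)
    qed
    then show "\<exists>\<delta>>0. \<exists>K. \<forall>s. b < s \<and> s < b + \<delta> \<longrightarrow>
        (\<exists>d. (u has_real_derivative d) (at s) \<and> d \<le> K * u s)"
      using \<delta> by blast
  qed
  then have "e t = 0" by (simp add: u_def add_nonneg_eq_0_iff)
  then show "\<gamma> t \<in> sphere 0 R0"
    using R0 by (simp add: e_def)
qed



end
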